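(* In the setting $\text{EZF}^*$ with $\neg CHS$-cardinality described in the context, let $X,Y$ be sets of $\text{EZF}^*$ such that $|X|_{\neg chs}<|Y|_{\neg chs}$. Then there is a set $U$ of $\text{EZF}^*$ such that $|X|_{\neg chs}<|U|_{\neg chs}<|Y|_{\neg chs}$.
   Context: Zermelo sets are the members of the von Neumann universe $\mathcal V$; $|X|$ is classical cardinality, $P(X)$ the power set. A Zermelo set is powered if it equals $P(X')$ for some Zermelo $X'$, otherwise non-powered. The theory is extended by membership relations $\in_n$ ($n\ge1$) and inverse powerset objects: for Zermelo $Y$, $P^{-1}(Y)$ has as $\in_1$-members exactly the elements of $Y$, and $P^{-n}(Y)$ denotes the $n$-fold iterate; for non-powered Zermelo $Y$ and $n\ge1$, $P^{-n}(Y)$ is a non-Zermelo set of level $n$, and $P^{-1}(P(X))=X$. Finite union forms $A_1\cup\dots\cup A_n$ exist (commutative, associative; union of Zermelo sets is classical union). $\text{EZF}^*$ consists of Zermelo sets, non-Zermelo sets of any level, and finite union forms of these; every element can be written $X_1\cup\dots\cup X_n$ with $X_1$ Zermelo (possibly empty), the others non-Zermelo; empty components may be appended so that two given sets have the same number $n$ of components. $\rho(Y)=0$ for nonempty Zermelo $Y$, $\rho(P^{-m}(Y))=-m$, $\rho(\emptyset)=-\infty$; $\tau(Y)=|Y|$ for Zermelo $Y$, $\tau(P^{-m}(Y))=|Y|$. $X_1\cup\dots\cup X_n$ is well-represented iff $\rho(X_1)\ge\dots\ge\rho(X_n)$ and, among consecutive components with equal $\rho$, $\tau$ is non-increasing.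 $\neg CHS$-cardinality: write $X=X_1\cup\dots\cup X_n$, $Y=Y_1\cup\dots\cup Y_n$ with $X_1,Y_1$ Zermelo (possibly empty), the remaining components non-Zermelo or empty, and $X_2\cup\dots\cup X_n$, $Y_2\cup\dots\cup Y_n$ well-represented. Then $|X|_{\neg chs}<|Y|_{\neg chs}$ iff there is $k\le n$ with $\rho(X_i)=\rho(Y_i)$ and $\tau(X_i)=\tau(Y_i)$ for all $i<k$, and either ($\rho(X_k)<\rho(Y_k)$ and $\tau(X_k)\le\tau(Y_k)$) or ($\rho(X_k)\le\rho(Y_k)$ and $\tau(X_k)<\tau(Y_k)$). $|X|_{\neg chs}=|Y|_{\neg chs}$ iff $\rho(X_j)=\rho(Y_j)$ and $\tau(X_j)=\tau(Y_j)$ for all $j\le n$. *)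

theory Defs
  imports "HOL-Library.Extended_Real" "HOL-Library.Multiset"
begin

unbundle cardinal_syntax
declare [[typedef_overloaded]]

section \<open>Zermelo sets\<close>

text \<open>
  A type of this class is a von Neumann universe. HOL cannot prove the consistency of ZFC, so
  the universe is a parameter. Replacement ranges over arbitrary HOL functions; Separation
  and Choice are then derivable (see below). Because every HOL bijection between members of
  the universe is itself a set of the universe, classical cardinality is the HOL cardinality
  \<^term>\<open>card_of (elts Y)\<close> of the set of elements.
\<close>

class zfc_universe =
  fixes elts :: "'a \<Rightarrow> 'a set"
  assumes extensionality: "elts x = elts y \<Longrightarrow> x = y"
    and foundation: "wf {(x, y). x \<in> elts y}"
    and pairing: "\<exists>z. elts z = {x, y}"
    and big_union: "\<exists>z. elts z = (\<Union>y\<in>elts x. elts y)"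
    and power_set: "\<exists>z. elts z = {y. elts y \<subseteq> elts x}"
    and replacement: "\<exists>z. elts z = F ` elts x"
    and infinity: "\<exists>z. (\<exists>e\<in>elts z. elts e = {}) \<and>
                       (\<forall>x\<in>elts z. \<exists>y\<in>elts z. elts y = insert x (elts x))"

definition zempty :: "'v::zfc_universe" where
  "zempty = (THE z. elts z = {})"

definition zunion :: "'v::zfc_universe \<Rightarrow> 'v \<Rightarrow> 'v" where
  "zunion x y = (THE z. elts z = elts x \<union> elts y)"

definition zpow :: "'v::zfc_universe \<Rightarrow> 'v" where
  "zpow x = (THE z. elts z = {y. elts y \<subseteq> elts x})"

definition powered :: "'v::zfc_universe \<Rightarrow> bool" where
  "powered Y \<longleftrightarrow> (\<exists>X. Y = zpow X)"

lemma the_elts: "\<exists>z. elts z = A \<Longrightarrow> elts (THE z. elts z = A) = A"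
  for A :: "'v::zfc_universe set"
  by (rule theI') (auto intro: extensionality)

lemma elts_zempty [simp]: "elts zempty = {}"
  unfolding zempty_def by (rule the_elts) (use infinity in blast)

lemma elts_zunion [simp]: "elts (zunion x y) = elts x \<union> elts y"
  unfolding zunion_def
proof (rule the_elts)
  obtain p where "elts p = {x, y}" using pairing by blast
  then show "\<exists>z. elts z = elts x \<union> elts y" using big_union[of p] by simp
qed

lemma elts_zpow [simp]: "elts (zpow x) = {y. elts y \<subseteq> elts x}"
  unfolding zpow_def by (rule the_elts) (rule power_set)

lemma zpow_inject [simp]: "zpow x = zpow y \<longleftrightarrow> x = y"
proof
  assume "zpow x = zpow y"
  then have "elts (zpow x) = elts (zpow y)" by simp
  then have "elts x = elts y" by auto
  then show "x = y" by (rule extensionality)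
qed simp

lemma not_powered_zempty: "\<not> powered zempty"
proof
  assume "powered (zempty :: 'a)"
  then obtain X :: 'a where "zempty = zpow X" unfolding powered_def by blast
  then have "elts (zpow X) = {}" by (metis elts_zempty)
  then show False by auto
qed

lemma separation: "\<exists>z. elts z = {y \<in> elts x. P y}" for x :: "'v::zfc_universe"
proof (cases "\<exists>a\<in>elts x. P a")
  case True
  then obtain a where a: "a \<in> elts x" "P a" by blast
  obtain z where "elts z = (\<lambda>y. if P y then y else a) ` elts x"
    using replacement by blast
  then have "elts z = {y \<in> elts x. P y}" using a by auto
  then show ?thesis by blast
next
  case False
  then have "elts zempty = {y \<in> elts x. P y}" by auto
  then show ?thesis by blast
qed

lemma choice:
  fixes x :: "'v::zfc_universe"
  assumes "\<forall>y\<in>elts x. elts y \<noteq> {}"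
    and "\<forall>y\<in>elts x. \<forall>z\<in>elts x. y \<noteq> z \<longrightarrow> elts y \<inter> elts z = {}"
  shows "\<exists>c. \<forall>y\<in>elts x. \<exists>!u. u \<in> elts c \<inter> elts y"
proof -
  obtain c where c: "elts c = (\<lambda>y. SOME u. u \<in> elts y) ` elts x"
    using replacement by blast
  have some: "(SOME u. u \<in> elts y) \<in> elts y" if "y \<in> elts x" for y
    using assms(1) that by (simp add: some_in_eq)
  have "\<exists>!u. u \<in> elts c \<inter> elts y" if y: "y \<in> elts x" for y
  proof (rule ex1I)
    show "(SOME u. u \<in> elts y) \<in> elts c \<inter> elts y" using c some y by auto
  next
    fix u assume "u \<in> elts c \<inter> elts y"
    then obtain z where z: "z \<in> elts x" "u = (SOME u. u \<in> elts z)" "u \<in> elts y"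
      using c by auto
    then have "z = y" using assms(2) some y by blast
    then show "u = (SOME u. u \<in> elts y)" using z by simp
  qed
  then show ?thesis by blast
qed

section \<open>Inverse powersets\<close>

text \<open>The pair \<open>(Y, n)\<close> stands for \<open>P\<^sup>-\<^sup>n(Y)\<close>.\<close>

typedef (overloaded) 'v nonzermelo = "{(Y :: 'v::zfc_universe, n :: nat). \<not> powered Y \<and> 1 \<le> n}"
  using not_powered_zempty by (intro exI[of _ "(zempty, 1)"]) auto

definition base :: "'v::zfc_universe nonzermelo \<Rightarrow> 'v" where
  "base a = fst (Rep_nonzermelo a)"

definition level :: "'v::zfc_universe nonzermelo \<Rightarrow> nat" where
  "level a = snd (Rep_nonzermelo a)"

datatype 'v obj = Zermelo 'v | NonZermelo "'v::zfc_universe nonzermelo"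

fun pinv :: "'v::zfc_universe obj \<Rightarrow> 'v obj" where
  "pinv (Zermelo Y) =
     (if powered Y then Zermelo (THE X. Y = zpow X) else NonZermelo (Abs_nonzermelo (Y, 1)))"
| "pinv (NonZermelo a) = NonZermelo (Abs_nonzermelo (base a, level a + 1))"

text \<open>
  \<open>mem n x a\<close> is \<open>x \<in>\<^sub>n a\<close>. In particular \<open>x \<in>\<^sub>n X\<close> means \<open>x \<in> P\<^sup>n(X)\<close> for Zermelo \<open>X\<close>, which
  is forced by \<open>P\<^sup>-\<^sup>1(P(X)) = X\<close>, and \<open>\<in>\<^sub>0\<close> is the classical membership.
\<close>

definition mem :: "nat \<Rightarrow> 'v::zfc_universe \<Rightarrow> 'v obj \<Rightarrow> bool" where
  "mem n x a \<longleftrightarrow> (\<exists>Y. a = (pinv ^^ n) (Zermelo Y) \<and> x \<in> elts Y)"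

lemma not_powered_base: "\<not> powered (base a)"
  and level_ge_1: "1 \<le> level a"
  using Rep_nonzermelo[of a] by (auto simp: base_def level_def)

lemma base_level_Abs:
  assumes "\<not> powered Y" "1 \<le> n"
  shows "base (Abs_nonzermelo (Y, n)) = Y" "level (Abs_nonzermelo (Y, n)) = n"
  using assms by (simp_all add: base_def level_def Abs_nonzermelo_inverse)

lemma nonzermelo_eqI: "base a = base b \<Longrightarrow> level a = level b \<Longrightarrow> a = b"
  by (metis Rep_nonzermelo_inject base_def level_def prod.expand)

lemma pinv_zpow [simp]: "pinv (Zermelo (zpow X)) = Zermelo X"
  by (auto simp: powered_def)

lemma pinv_funpow_not_powered:
  assumes "\<not> powered Y" "1 \<le> n"
  shows "(pinv ^^ n) (Zermelo Y) = NonZermelo (Abs_nonzermelo (Y, n))"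
  using assms(2)
proof (induction n rule: dec_induct)
  case base
  then show ?case using assms(1) by simp
next
  case (step n)
  then show ?case using assms(1) by (simp add: base_level_Abs)
qed

lemma inj_pinv: "inj pinv"
proof (rule injI)
  fix a b :: "'v::zfc_universe obj"
  have Z: "pinv (Zermelo Y) = Zermelo X \<longleftrightarrow> Y = zpow X" for X Y :: 'v
    by (auto simp: powered_def)
  have N: "pinv (NonZermelo c) \<noteq> pinv (Zermelo Y)" for c and Y :: 'v
  proof
    assume *: "pinv (NonZermelo c) = pinv (Zermelo Y)"
    then have Y: "\<not> powered Y" by (auto split: if_splits)
    have "level (Abs_nonzermelo (base c, level c + 1)) = level (Abs_nonzermelo (Y, 1))"
      using * Y by simp
    then show False using Y level_ge_1[of c] not_powered_base[of c] by (simp add: base_level_Abs)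
  qed
  assume eq: "pinv a = pinv b"
  show "a = b"
  proof (cases a)
    case a: (Zermelo Y)
    then obtain Y' where b: "b = Zermelo Y'" using eq N by (metis obj.exhaust)
    show ?thesis
    proof (cases "powered Y")
      case True
      then show ?thesis using eq a b Z unfolding powered_def by (metis pinv_zpow)
    next
      case False
      then have nY': "\<not> powered Y'" using eq a b by (auto split: if_splits)
      then have "base (Abs_nonzermelo (Y, 1)) = base (Abs_nonzermelo (Y', 1))"
        using eq a b False by simp
      then show ?thesis using a b False nY' by (simp add: base_level_Abs)
    qed
  next
    case a: (NonZermelo c)
    then obtain d where b: "b = NonZermelo d" using eq N by (metis obj.exhaust)
    have e: "Abs_nonzermelo (base c, level c + 1) = Abs_nonzermelo (base d, level d + 1)"
      using eq a b by simp
    have "base c = base d" "level c + 1 = level d + 1"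
      using arg_cong[OF e, of base] arg_cong[OF e, of level]
      by (simp_all add: base_level_Abs not_powered_base)
    then show ?thesis using a b by (simp add: nonzermelo_eqI)
  qed
qed

lemma mem_pinv_iff: "mem n x ((pinv ^^ n) (Zermelo Y)) \<longleftrightarrow> x \<in> elts Y"
proof -
  have "inj (pinv ^^ n :: 'a obj \<Rightarrow> 'a obj)" by (intro inj_fn inj_pinv)
  then show ?thesis unfolding mem_def by (auto dest: injD)
qed

section \<open>Finite union forms\<close>

text \<open>
  Union forms are commutative and associative but not idempotent: \<open>P\<^sup>-\<^sup>1(Y) \<union> P\<^sup>-\<^sup>1(Y)\<close> is not
  identified with \<open>P\<^sup>-\<^sup>1(Y)\<close>. The Zermelo components merge into one classical union, and the
  empty set is neutral; hence a Zermelo set and a finite multiset of non-Zermelo sets.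
\<close>

datatype 'v ezf = Form 'v "'v::zfc_universe nonzermelo multiset"

fun ezf_of :: "'v::zfc_universe obj \<Rightarrow> 'v ezf" where
  "ezf_of (Zermelo Y) = Form Y {#}"
| "ezf_of (NonZermelo a) = Form zempty {#a#}"

fun ezf_union :: "'v::zfc_universe ezf \<Rightarrow> 'v ezf \<Rightarrow> 'v ezf" where
  "ezf_union (Form Y M) (Form Z N) = Form (zunion Y Z) (M + N)"

definition union_form :: "'v::zfc_universe obj list \<Rightarrow> 'v ezf" where
  "union_form xs = foldr (\<lambda>x. ezf_union (ezf_of x)) xs (ezf_of (Zermelo zempty))"

lemma ezf_union_commute: "ezf_union A B = ezf_union B A"
  by (cases A; cases B) (auto intro!: extensionality)

lemma ezf_union_assoc: "ezf_union (ezf_union A B) C = ezf_union A (ezf_union B C)"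
  by (cases A; cases B; cases C) (auto intro!: extensionality)

lemma ezf_union_empty: "ezf_union A (ezf_of (Zermelo zempty)) = A"
  by (cases A) (auto intro!: extensionality)

lemma ezf_union_Zermelo:
  "ezf_union (ezf_of (Zermelo Y)) (ezf_of (Zermelo Z)) = ezf_of (Zermelo (zunion Y Z))"
  by simp

section \<open>The cardinality\<close>

fun rho :: "'v::zfc_universe obj \<Rightarrow> ereal" where
  "rho (Zermelo Y) = (if Y = zempty then -\<infinity> else 0)"
| "rho (NonZermelo a) = - ereal (real (level a))"

text \<open>Values of \<open>tau\<close> are HOL cardinals, so they are compared with \<open>=o\<close>, \<open>\<le>o\<close> and \<open><o\<close>.\<close>

fun tau :: "'v::zfc_universe obj \<Rightarrow> 'v rel" where
  "tau (Zermelo Y) = |elts Y|"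
| "tau (NonZermelo a) = |elts (base a)|"

definition well_represented :: "'v::zfc_universe obj list \<Rightarrow> bool" where
  "well_represented xs \<longleftrightarrow>
     (\<forall>i. Suc i < length xs \<longrightarrow>
        rho (xs ! Suc i) \<le> rho (xs ! i) \<and>
        (rho (xs ! i) = rho (xs ! Suc i) \<longrightarrow> tau (xs ! Suc i) \<le>o tau (xs ! i)))"

definition represents :: "'v::zfc_universe obj list \<Rightarrow> 'v ezf \<Rightarrow> bool" where
  "represents xs X \<longleftrightarrow>
     xs \<noteq> [] \<and> X = union_form xs \<and>
     (\<exists>Y. hd xs = Zermelo Y) \<and>
     (\<forall>x\<in>set (tl xs). (\<exists>a. x = NonZermelo a) \<or> x = Zermelo zempty) \<and>
     well_represented (tl xs)"

definition nchs_less :: "'v::zfc_universe ezf \<Rightarrow> 'v ezf \<Rightarrow> bool" where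
  "nchs_less X Y \<longleftrightarrow>
     (\<exists>xs ys. represents xs X \<and> represents ys Y \<and> length xs = length ys \<and>
        (\<exists>k<length xs.
           (\<forall>i<k. rho (xs ! i) = rho (ys ! i) \<and> tau (xs ! i) =o tau (ys ! i)) \<and>
           (rho (xs ! k) < rho (ys ! k) \<and> tau (xs ! k) \<le>o tau (ys ! k) \<or>
            rho (xs ! k) \<le> rho (ys ! k) \<and> tau (xs ! k) <o tau (ys ! k))))"

definition nchs_eq :: "'v::zfc_universe ezf \<Rightarrow> 'v ezf \<Rightarrow> bool" where
  "nchs_eq X Y \<longleftrightarrow>
     (\<exists>xs ys. represents xs X \<and> represents ys Y \<and> length xs = length ys \<and>
        (\<forall>i<length xs. rho (xs ! i) = rho (ys ! i) \<and> tau (xs ! i) =o tau (ys ! i)))"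

end

theory Submission
  imports Defs
begin

text \<open>
  Take \<open>U = X \<union> P\<^sup>-\<^sup>m(\<emptyset>)\<close>, where \<open>m\<close> exceeds every level occurring in \<open>X\<close> and \<open>Y\<close>. The new
  component comes directly after the nonempty components of \<open>X\<close>, where \<open>X\<close> itself only has empty
  padding, so \<open>X < U\<close>. If \<open>X\<close> and \<open>Y\<close> first differ at a nonempty component of \<open>X\<close> (or at the
  Zermelo component), then \<open>U < Y\<close> for the same reason as \<open>X < Y\<close>. Otherwise they first differ
  exactly at the position of the new component, where \<open>Y\<close> has some \<open>P\<^sup>-\<^sup>l(B)\<close> with \<open>l < m\<close>.
\<close>

abbreviation (input) zero_obj :: "'v::zfc_universe obj" where
  "zero_obj \<equiv> Zermelo zempty"

text \<open>The constraint that \<open>well_represented\<close> puts on neighbours, isolated as a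
  relation so that \<open>sorted_wrt\<close> can be applied to it.\<close>

definition comp_ge :: "'v::zfc_universe obj \<Rightarrow> 'v obj \<Rightarrow> bool" where
  "comp_ge x y \<longleftrightarrow> rho y \<le> rho x \<and> (rho x = rho y \<longrightarrow> tau y \<le>o tau x)"

text \<open>If the outer values of \<open>rho\<close> coincide, antisymmetry makes the middle one
  equal too, so both \<open>tau\<close> comparisons are available and chain.\<close>

lemma transp_comp_ge: "transp comp_ge"
proof (rule transpI)
  fix x y z :: "'v::zfc_universe obj"
  assume "comp_ge x y" "comp_ge y z"
  then show "comp_ge x z"
    unfolding comp_ge_def by (metis order.antisym order.trans ordLeq_transitive)
qed

lemma well_represented_iff_sorted_wrt: "well_represented xs \<longleftrightarrow> sorted_wrt comp_ge xs"
  unfolding sorted_wrt_iff_nth_Suc_transp[OF transp_comp_ge] well_represented_def comp_ge_def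
  by auto

lemma tau_zero_le: "tau (zero_obj :: 'v obj) \<le>o tau x" for x :: "'v::zfc_universe obj"
  by (cases x) (simp_all add: card_of_empty)

lemma comp_ge_zero: "comp_ge x zero_obj"
  by (simp add: comp_ge_def tau_zero_le del: tau.simps)

lemma union_form_append_zero: "union_form (xs @ [zero_obj]) = union_form xs"
  by (simp add: union_form_def ezf_union_empty[simplified])

lemma sorted_wrt_replicate_zero: "sorted_wrt comp_ge (replicate p zero_obj)"
  by (induction p) (simp_all add: comp_ge_zero)

lemma represents_append_zero: "represents xs X \<Longrightarrow> represents (xs @ [zero_obj]) X"
  unfolding represents_def
  by (auto simp: union_form_append_zero well_represented_iff_sorted_wrt sorted_wrt_append
      comp_ge_zero)

text \<open>The empty set has \<open>rho\<close> equal to -\<infinity>, whereas every non-Zermelo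
  set has a finite one.\<close>

lemma zero_if_comp_ge_zero:
  assumes "comp_ge zero_obj y" "(\<exists>a. y = NonZermelo a) \<or> y = zero_obj"
  shows "y = zero_obj"
  using assms by (auto simp: comp_ge_def)

text \<open>Nothing nonempty can follow an empty component, so the padding is a suffix.\<close>

lemma sorted_split_zero:
  assumes "sorted_wrt comp_ge zs" "\<forall>z\<in>set zs. (\<exists>a. z = NonZermelo a) \<or> z = zero_obj"
  obtains A p where "zs = A @ replicate p zero_obj" "\<forall>z\<in>set A. \<exists>a. z = NonZermelo a"
proof -
  have "\<exists>A p. zs = A @ replicate p zero_obj \<and> (\<forall>z\<in>set A. \<exists>a. z = NonZermelo a)"
    using assms
  proof (induction zs)
    case Nil
    then show ?case by simp
  next
    case (Cons z zs)
    show ?case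
    proof (cases "z = zero_obj")
      case True
      then have "\<forall>y\<in>set zs. y = zero_obj"
        using Cons.prems zero_if_comp_ge_zero by auto
      then have "z # zs = [] @ replicate (Suc (length zs)) zero_obj"
        using True by (simp add: replicate_length_same)
      then show ?thesis by (metis empty_iff list.set(1))
    next
      case False
      then obtain a where "z = NonZermelo a" using Cons.prems by auto
      moreover obtain A p where "zs = A @ replicate p zero_obj"
        "\<forall>z\<in>set A. \<exists>a. z = NonZermelo a"
        using Cons by auto
      ultimately have "z # zs = (z # A) @ replicate p zero_obj \<and>
          (\<forall>z\<in>set (z # A). \<exists>a. z = NonZermelo a)" by simp
      then show ?thesis by blast
    qed
  qed
  then show thesis using that by blast
qed

lemma level_bound: obtains m where "\<forall>a. NonZermelo a \<in> set xs \<longrightarrow> level a < m"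
proof -
  have "finite (NonZermelo -` set xs)"
    by (intro finite_vimageI) (auto intro: injI)
  then have "finite (level ` (NonZermelo -` set xs))" by simp
  then obtain m where "\<forall>l\<in>level ` (NonZermelo -` set xs). l < m"
    using finite_nat_set_iff_bounded by blast
  then show thesis using that by blast
qed

definition comp_less :: "'v::zfc_universe obj \<Rightarrow> 'v obj \<Rightarrow> bool" where
  "comp_less x y \<longleftrightarrow> rho x < rho y \<and> tau x \<le>o tau y \<or> rho x \<le> rho y \<and> tau x <o tau y"

lemma nchs_lessI:
  assumes "represents xs X" "represents ys Y" "length xs = length ys" "k < length xs"
    and "\<And>i. i < k \<Longrightarrow> rho (xs ! i) = rho (ys ! i) \<and> tau (xs ! i) =o tau (ys ! i)"
    and "comp_less (xs ! k) (ys ! k)"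
  shows "nchs_less X Y"
  using assms unfolding nchs_less_def comp_less_def by blast

text \<open>The empty set minimises both \<open>rho\<close> and \<open>tau\<close>. Hence, at the
  first difference, the larger side has a nonempty component.\<close>

lemma not_comp_less_zero: "\<not> comp_less x zero_obj"
  using tau_zero_le not_ordLess_ordLeq by (auto simp: comp_less_def simp del: tau.simps)

lemma tau_refl: "tau x =o tau x"
  by (cases x) (simp_all add: card_of_refl)

theorem theorem4:
  fixes X Y :: "'v::zfc_universe ezf"
  assumes "nchs_less X Y"
  shows "\<exists>U. nchs_less X U \<and> nchs_less U Y"
proof -
  obtain xs ys k where X: "represents xs X" and Y: "represents ys Y"
    and len: "length xs = length ys" and k: "k < length xs"
    and eq: "\<forall>i<k. rho (xs ! i) = rho (ys ! i) \<and> tau (xs ! i) =o tau (ys ! i)"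
    and less: "comp_less (xs ! k) (ys ! k)"
    using assms unfolding nchs_less_def comp_less_def by blast
  obtain m where m: "\<forall>a. NonZermelo a \<in> set (xs @ ys) \<longrightarrow> level a < m"
    using level_bound by blast
  \<comment> \<open>\<open>Suc m\<close> instead of \<open>m\<close> guarantees a level of at least
    1, even when no non-Zermelo component occurs. The base \<open>zempty\<close> is non-powered and
    has the least \<open>tau\<close>, so \<open>rho\<close> alone decides comparisons with
    \<open>z\<close>.\<close>
  define z :: "'v obj" where "z = NonZermelo (Abs_nonzermelo (zempty, Suc m))"
  have rho_z: "rho z = - ereal (real (Suc m))"
    by (simp add: z_def base_level_Abs not_powered_zempty)
  have tau_z: "tau z = tau zero_obj"
    by (simp add: z_def base_level_Abs not_powered_zempty)
  have z_less: "rho z < rho (NonZermelo a)" if "NonZermelo a \<in> set (xs @ ys)" for a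
    using m that unfolding rho_z by fastforce
  obtain Z where Z: "xs = Z # tl xs" "\<exists>W. Z = Zermelo W"
    using X unfolding represents_def by (metis list.collapse)
  have "sorted_wrt comp_ge (tl xs)"
      "\<forall>z\<in>set (tl xs). (\<exists>a. z = NonZermelo a) \<or> z = zero_obj"
    using X unfolding represents_def well_represented_iff_sorted_wrt by auto
  then obtain A p where tl: "tl xs = A @ replicate p zero_obj"
    and A: "\<forall>z\<in>set A. \<exists>a. z = NonZermelo a"
    by (rule sorted_split_zero)
  have xs: "xs = Z # A @ replicate p zero_obj" using Z tl by simp
  \<comment> \<open>Padded by one empty component, \<open>xs\<close> has the length of
    \<open>us\<close> below and differs from it only at \<open>?j\<close>, where \<open>z\<close>
    replaces an empty set.\<close>
  have xs': "xs @ [zero_obj] = Z # A @ zero_obj # replicate p zero_obj"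
    unfolding xs by (simp add: replicate_append_same)
  define us where "us = Z # A @ z # replicate p zero_obj"
  define U where "U = union_form us"
  let ?j = "Suc (length A)"
  have lens: "length us = Suc (length xs)" "?j \<le> length xs"
    unfolding us_def xs by simp_all
  have "sorted_wrt comp_ge A"
    using X unfolding represents_def well_represented_iff_sorted_wrt tl
    by (simp add: sorted_wrt_append)
  \<comment> \<open>The inequality of \<open>rho\<close> is strict, so the \<open>tau\<close>
    condition is vacuous.\<close>
  moreover have "comp_ge a z" if a: "a \<in> set A" for a
  proof -
    obtain b where "a = NonZermelo b" using A a by blast
    moreover have "a \<in> set (xs @ ys)" using a unfolding xs by simp
    ultimately have "rho z < rho a" using z_less by metis
    then show ?thesis unfolding comp_ge_def by auto
  qed
  ultimately have "well_represented (tl us)"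
    unfolding well_represented_iff_sorted_wrt us_def
    by (auto simp: sorted_wrt_append comp_ge_zero sorted_wrt_replicate_zero)
  then have U: "represents us U"
    using A Z(2) unfolding represents_def U_def by (auto simp: us_def z_def)
  have us_nth: "us ! i = (xs @ [zero_obj]) ! i" if "i < ?j" for i
    using that unfolding xs' us_def by (cases i) (auto simp: nth_append)
  have us_j: "us ! ?j = z" "(xs @ [zero_obj]) ! ?j = zero_obj"
    unfolding xs' us_def by (simp_all add: nth_append)
  have "nchs_less X U"
  proof (rule nchs_lessI[OF represents_append_zero[OF X] U])
    show "comp_less ((xs @ [zero_obj]) ! ?j) (us ! ?j)"
      unfolding us_j comp_less_def using tau_zero_le[of z] by (simp add: rho_z del: tau.simps)
  qed (use lens us_nth tau_refl in auto)
  moreover have "nchs_less U Y"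
  proof (rule nchs_lessI[OF U represents_append_zero[OF Y]])
    have kys: "(ys @ [zero_obj]) ! i = ys ! i" "(xs @ [zero_obj]) ! i = xs ! i" if "i \<le> k" for i
      using that k len by (auto simp: nth_append)
    \<comment> \<open>Below \<open>?j\<close> the lists \<open>us\<close> and padded
      \<open>xs\<close> agree, so only a first difference at or after \<open>?j\<close> needs an
      argument.\<close>
    have kj: "k \<le> ?j \<and> (k = ?j \<longrightarrow> comp_less z (ys ! k))"
    proof (cases "k < ?j")
      case False
      define ts where "ts = tl ys"
      have ys: "ys = hd ys # ts" using Y unfolding ts_def represents_def by simp
      have nth: "ys ! Suc i = ts ! i" for i by (subst ys) simp
      have ts: "sorted_wrt comp_ge ts" "\<forall>y\<in>set ts. (\<exists>a. y = NonZermelo a) \<or> y = zero_obj"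
        using Y unfolding ts_def represents_def well_represented_iff_sorted_wrt by auto
      obtain l where l: "k = Suc l" using False by (cases k) auto
      then have l_len: "l < length ts" using k len ys by (metis Suc_less_eq length_Cons)
      have "ts ! l \<noteq> zero_obj"
        using less not_comp_less_zero unfolding l nth by metis
      then obtain a where a: "ts ! l = NonZermelo a" using ts l_len by (meson nth_mem)
      have "k = ?j"
      proof (rule ccontr)
        assume "k \<noteq> ?j"
        then have j: "length A < l" using False l by simp
        \<comment> \<open>A first difference after \<open>?j\<close> would make \<open>ys\<close>
          agree in \<open>rho\<close> with the padding of \<open>xs\<close> at \<open>?j\<close>.
          Then \<open>ys\<close> would have an empty component before the nonempty one at
          \<open>k\<close>, against its ordering.\<close>
        have "rho (ts ! length A) = rho ((xs @ [zero_obj]) ! ?j)"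
          using eq kys(2)[of ?j] j unfolding l by (simp add: nth)
        then have "rho (ts ! length A) = -\<infinity>" unfolding us_j by simp
        moreover have "comp_ge (ts ! length A) (ts ! l)"
          using ts j l_len by (simp add: sorted_wrt_iff_nth_less)
        ultimately show False using a by (simp add: comp_ge_def)
      qed
      moreover have "NonZermelo a \<in> set ys" using a l_len ys by (metis nth_mem list.set_intros(2))
      then have "comp_less z (ys ! k)"
        using z_less[of a] tau_zero_le[of "NonZermelo a"]
        unfolding comp_less_def l nth a tau_z by (simp del: rho.simps tau.simps)
      ultimately show ?thesis by simp
    qed simp
    \<comment> \<open>For \<open>k < ?j\<close> this is \<open>less\<close> itself; for
      \<open>k = ?j\<close> it is the second half of \<open>kj\<close>.\<close>
    show "comp_less (us ! k) ((ys @ [zero_obj]) ! k)"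
      using kj us_nth[of k] us_j kys[of k] less by (cases "k = ?j") auto
    show "rho (us ! i) = rho ((ys @ [zero_obj]) ! i) \<and> tau (us ! i) =o tau ((ys @ [zero_obj]) ! i)"
      if "i < k" for i
      using that kj us_nth[of i] kys[of i] eq by simp
  qed (use lens len k in auto)
  ultimately show ?thesis by blast
qed

end
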